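(* Let $A$ be a flexible algebra over a field $F$ with $\mathrm{char}(F)\neq 2$. (1) Any axis $a\in A$ has some Jordan type $(\lambda,\delta)$, with either $\lambda=\delta$, so that $a\in C(A)$, or $\lambda+\delta=1$, $\lambda\neq\delta$, and $x^2=0$ for all $x\in A_{\lambda,\delta}(a)$. (2) Let $a\neq b$ be axes in $A$, neither of which is in $C(A)$. Then either $ab=0$, or the subalgebra of $A$ generated by $a$ and $b$ is isomorphic to one of the algebras $B_1(\lambda,\delta)$, $B_2(\lambda,\delta)$ defined in the context, for some $\lambda,\delta\in F\setminus\{0,1\}$ with $\lambda+\delta=1$ and $\lambda\neq\delta$.
   Context: Algebras are not necessarily associative, commutative or unital. $A$ is flexible if $(xy)x=x(yx)$ for all $x,y\in A$. $C(A)=\{x\in A: xy=yx \text{ for all } y\in A\}$. For $a\in A$ put $L_a(x)=ax$, $R_a(x)=xa$; for $X\in\{L,R\}$ let $A_\lambda(X_a)=\{v: X_a(v)=\lambda v\}$, write $A_\lambda=A_\lambda(L_a)$, and $A_{\lambda,\delta}(a)=A_\lambda(L_a)\cap A_\delta(R_a)$ (written $A_{\lambda,\delta}$ when $a$ is understood). Let $a$ be an idempotent ($a^2=a$) and $\lambda,\delta\in F\setminus\{0,1\}$. $a$ is a left axis of type $\lambda$ if: (a) $A_1(L_a)=Fa$; (b) $(L_a-\lambda)(L_a-1)L_a=0$; (c) the decomposition $A=(A_0\oplus A_1)\oplus A_\lambda$ (eigenspaces of $L_a$) is a $\mathbb Z_2$-grading of $A$ with $+$-part $A_0\oplus A_1$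 and $-$-part $A_\lambda$. ($A_0$ is not required to be a subalgebra.) A right axis of type $\delta$ is defined similarly using $R_a$. $a$ is an axis of type $(\lambda,\delta)$ if it is a left axis of type $\lambda$, a right axis of type $\delta$, and $L_aR_a=R_aL_a$; an axis is an axis of type $(\lambda,\delta)$ for some $\lambda,\delta\in F\setminus\{0,1\}$. An axis $a$ of type $(\lambda,\delta)$ is of Jordan type $(\lambda,\delta)$ if $A_{\lambda,0}=A_{0,\delta}=0$. For $\lambda,\delta\in F\setminus\{0,1\}$ with $\lambda+\delta=1$ and $\lambda\neq\delta$: $B_1(\lambda,\delta)$ is the $2$-dimensional algebra with basis $a,b$ and multiplication $a^2=a$, $b^2=b$, $ab=\delta a+\lambda b$, $ba=\lambda a+\delta b$. $B_2(\lambda,\delta)$ is the $3$-dimensional algebra with basis $a,b,x$ and multiplication $a^2=a$, $b^2=b$, $x^2=0$, $ab=ax=xb=\lambda x$, $ba=xa=bx=\delta x$. *)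

theory Defs
  imports
    Complex_Main
    "HOL-Library.Product_Plus"
begin

locale nonassoc_algebra = vector_space scale
  for scale :: "'f::field \<Rightarrow> 'v::ab_group_add \<Rightarrow> 'v" +
  fixes mult :: "'v \<Rightarrow> 'v \<Rightarrow> 'v"
  assumes linear_mult_left: "Vector_Spaces.linear scale scale (\<lambda>y. mult x y)"
    and linear_mult_right: "Vector_Spaces.linear scale scale (\<lambda>x. mult x y)"
begin

definition subalgebra :: "'v set \<Rightarrow> bool" where
  "subalgebra S \<longleftrightarrow> subspace S \<and> (\<forall>x\<in>S. \<forall>y\<in>S. mult x y \<in> S)"

definition generated_subalgebra :: "'v set \<Rightarrow> 'v set" where
  "generated_subalgebra X = subalgebra hull X"

text \<open>Only commutation is required, not associativity with the other elements.\<close>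

definition center :: "'v set" where
  "center = {x. \<forall>y. mult x y = mult y x}"

definition L :: "'v \<Rightarrow> 'v \<Rightarrow> 'v" where
  "L a x = mult a x"

definition R :: "'v \<Rightarrow> 'v \<Rightarrow> 'v" where
  "R a x = mult x a"

definition eigenspace :: "('v \<Rightarrow> 'v) \<Rightarrow> 'f \<Rightarrow> 'v set" where
  "eigenspace T c = {v. T v = scale c v}"

definition eigenspace2 :: "'v \<Rightarrow> 'f \<Rightarrow> 'f \<Rightarrow> 'v set" where
  "eigenspace2 a lam \<delta> = eigenspace (L a) lam \<inter> eigenspace (R a) \<delta>"

definition is_direct_sum :: "'v set \<Rightarrow> 'v set \<Rightarrow> 'v set \<Rightarrow> bool" where
  "is_direct_sum U V W \<longleftrightarrow>
     subspace U \<and> subspace V \<and> U \<inter> V = {0} \<and> W = {u + v |u v. u \<in> U \<and> v \<in> V}"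

definition Z2_grading :: "'v set \<Rightarrow> 'v set \<Rightarrow> bool" where
  "Z2_grading P M \<longleftrightarrow>
     is_direct_sum P M UNIV \<and>
     (\<forall>x\<in>P. \<forall>y\<in>P. mult x y \<in> P) \<and>
     (\<forall>x\<in>P. \<forall>y\<in>M. mult x y \<in> M) \<and>
     (\<forall>x\<in>M. \<forall>y\<in>P. mult x y \<in> M) \<and>
     (\<forall>x\<in>M. \<forall>y\<in>M. mult x y \<in> P)"

text \<open>The axis conditions relative to an operator \<open>T\<close>, which is \<open>L a\<close> or \<open>R a\<close> below.
  The set \<open>P\<close> is the even part, the direct sum of the eigenspaces for 0 and 1.\<close>

definition one_sided_axis :: "('v \<Rightarrow> 'v) \<Rightarrow> 'v \<Rightarrow> 'f \<Rightarrow> bool" where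
  "one_sided_axis T a c \<longleftrightarrow>
     mult a a = a \<and> c \<noteq> 0 \<and> c \<noteq> 1 \<and>
     eigenspace T 1 = span {a} \<and>
     ((\<lambda>v. T v - scale c v) \<circ> (\<lambda>v. T v - v) \<circ> T) = (\<lambda>v. 0) \<and>
     (\<exists>P. is_direct_sum (eigenspace T 0) (eigenspace T 1) P \<and> Z2_grading P (eigenspace T c))"

definition left_axis :: "'v \<Rightarrow> 'f \<Rightarrow> bool" where
  "left_axis a lam \<longleftrightarrow> one_sided_axis (L a) a lam"

definition right_axis :: "'v \<Rightarrow> 'f \<Rightarrow> bool" where
  "right_axis a \<delta> \<longleftrightarrow> one_sided_axis (R a) a \<delta>"

definition axis_of_type :: "'v \<Rightarrow> 'f \<Rightarrow> 'f \<Rightarrow> bool" where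
  "axis_of_type a lam \<delta> \<longleftrightarrow> left_axis a lam \<and> right_axis a \<delta> \<and> L a \<circ> R a = R a \<circ> L a"

definition axis :: "'v \<Rightarrow> bool" where
  "axis a \<longleftrightarrow> (\<exists>lam \<delta>. axis_of_type a lam \<delta>)"

definition axis_of_Jordan_type :: "'v \<Rightarrow> 'f \<Rightarrow> 'f \<Rightarrow> bool" where
  "axis_of_Jordan_type a lam \<delta> \<longleftrightarrow>
     axis_of_type a lam \<delta> \<and> eigenspace2 a lam 0 = {0} \<and> eigenspace2 a 0 \<delta> = {0}"

end

locale flexible_algebra = nonassoc_algebra scale mult
  for scale :: "'f::field \<Rightarrow> 'v::ab_group_add \<Rightarrow> 'v" and mult :: "'v \<Rightarrow> 'v \<Rightarrow> 'v" +
  assumes flexible: "mult (mult x y) x = mult x (mult y x)"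

definition algebra_iso ::
  "('f::field \<Rightarrow> 'v::ab_group_add \<Rightarrow> 'v) \<Rightarrow> ('v \<Rightarrow> 'v \<Rightarrow> 'v) \<Rightarrow> 'v set \<Rightarrow>
   ('f \<Rightarrow> 'w::ab_group_add \<Rightarrow> 'w) \<Rightarrow> ('w \<Rightarrow> 'w \<Rightarrow> 'w) \<Rightarrow> 'w set \<Rightarrow> ('v \<Rightarrow> 'w) \<Rightarrow> bool" where
  "algebra_iso scale mult S scale' mult' S' \<phi> \<longleftrightarrow>
     bij_betw \<phi> S S' \<and>
     (\<forall>x\<in>S. \<forall>y\<in>S. \<phi> (x + y) = \<phi> x + \<phi> y) \<and>
     (\<forall>c. \<forall>x\<in>S. \<phi> (scale c x) = scale' c (\<phi> x)) \<and>
     (\<forall>x\<in>S. \<forall>y\<in>S. \<phi> (mult x y) = mult' (\<phi> x) (\<phi> y))"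

definition isomorphic_algebras ::
  "('f::field \<Rightarrow> 'v::ab_group_add \<Rightarrow> 'v) \<Rightarrow> ('v \<Rightarrow> 'v \<Rightarrow> 'v) \<Rightarrow> 'v set \<Rightarrow>
   ('f \<Rightarrow> 'w::ab_group_add \<Rightarrow> 'w) \<Rightarrow> ('w \<Rightarrow> 'w \<Rightarrow> 'w) \<Rightarrow> 'w set \<Rightarrow> bool" where
  "isomorphic_algebras scale mult S scale' mult' S' \<longleftrightarrow>
     (\<exists>\<phi>. algebra_iso scale mult S scale' mult' S' \<phi>)"

text \<open>The algebra \<open>B\<^sub>1\<close> lives on \<open>F\<^sup>2\<close>: the pair \<open>(p, q)\<close> stands for \<open>p a + q b\<close>.
  The product is the bilinear extension of the multiplication table of the basis,
  recorded in \<open>B1_table\<close>.\<close>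

fun B1_scale :: "'f::field \<Rightarrow> 'f \<times> 'f \<Rightarrow> 'f \<times> 'f" where
  "B1_scale c (p, q) = (c * p, c * q)"

fun B1_mult :: "'f::field \<Rightarrow> 'f \<Rightarrow> 'f \<times> 'f \<Rightarrow> 'f \<times> 'f \<Rightarrow> 'f \<times> 'f" where
  "B1_mult lam \<delta> (p, q) (p', q') =
     (p * p' + \<delta> * (p * q') + lam * (q * p'),
      q * q' + lam * (p * q') + \<delta> * (q * p'))"

text \<open>The algebra \<open>B\<^sub>2\<close> lives on \<open>F\<^sup>3\<close>: the triple \<open>(p, q, r)\<close> stands for
  \<open>p a + q b + r x\<close>; see \<open>B2_table\<close>.\<close>

fun B2_scale :: "'f::field \<Rightarrow> 'f \<times> 'f \<times> 'f \<Rightarrow> 'f \<times> 'f \<times> 'f" where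
  "B2_scale c (p, q, r) = (c * p, c * q, c * r)"

fun B2_mult :: "'f::field \<Rightarrow> 'f \<Rightarrow> 'f \<times> 'f \<times> 'f \<Rightarrow> 'f \<times> 'f \<times> 'f \<Rightarrow> 'f \<times> 'f \<times> 'f" where
  "B2_mult lam \<delta> (p, q, r) (p', q', r') =
     (p * p', q * q',
      lam * (p * q' + p * r' + r * q') + \<delta> * (q * p' + r * p' + q * r'))"

lemma B1_algebra: "nonassoc_algebra B1_scale (B1_mult lam \<delta>)"
  by unfold_locales (auto simp: algebra_simps)

lemma B2_algebra: "nonassoc_algebra B2_scale (B2_mult lam \<delta>)"
  by unfold_locales (auto simp: algebra_simps)

lemma B1_table:
  fixes lam \<delta> :: "'f::field"
  defines "a \<equiv> (1, 0)" and "b \<equiv> (0, 1)"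
  shows "B1_mult lam \<delta> a a = a" "B1_mult lam \<delta> b b = b"
    "B1_mult lam \<delta> a b = B1_scale \<delta> a + B1_scale lam b"
    "B1_mult lam \<delta> b a = B1_scale lam a + B1_scale \<delta> b"
  by (simp_all add: a_def b_def)

lemma B2_table:
  fixes lam \<delta> :: "'f::field"
  defines "a \<equiv> (1, 0, 0)" and "b \<equiv> (0, 1, 0)" and "x \<equiv> (0, 0, 1)"
  shows "B2_mult lam \<delta> a a = a" "B2_mult lam \<delta> b b = b" "B2_mult lam \<delta> x x = 0"
    "B2_mult lam \<delta> a b = B2_scale lam x" "B2_mult lam \<delta> a x = B2_scale lam x"
    "B2_mult lam \<delta> x b = B2_scale lam x"
    "B2_mult lam \<delta> b a = B2_scale \<delta> x" "B2_mult lam \<delta> x a = B2_scale \<delta> x"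
    "B2_mult lam \<delta> b x = B2_scale \<delta> x"
  by (simp_all add: a_def b_def x_def zero_prod_def)

end

theory Submission
  imports Defs
begin

text \<open>Write \<open>v = c a + u + w\<close> with \<open>a u = 0\<close> and \<open>a w = lam w\<close>. Linearized flexibility on
  \<open>(a, a, v)\<close> forces \<open>u a = 0\<close>, \<open>w a = \<delta> w\<close> and, if \<open>w \<noteq> 0\<close>, \<open>lam = \<delta>\<close> or \<open>lam + \<delta> = 1\<close>; this is
  the first part. For the second part decompose \<open>b = \<alpha> a + u + w\<close> with respect to \<open>a\<close>. The cubic
  equation of \<open>L b\<close>, applied to \<open>a\<close>, shows that \<open>\<alpha>\<close> is an eigenvalue of \<open>L b\<close>. If \<open>w = 0\<close> this
  gives \<open>a b = 0\<close>. If \<open>w \<noteq> 0\<close>, then \<open>w\<close> is an eigenvector of \<open>L b\<close> for the third eigenvalue, which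
  excludes that value for \<open>\<alpha>\<close>; \<open>\<alpha> = 1\<close> gives \<open>b = a + w\<close> and \<open>B\<^sub>1\<close>, while \<open>\<alpha> = 0\<close> gives
  \<open>b = u + w\<close> and \<open>B\<^sub>2\<close> with \<open>x = w\<close>.\<close>

section \<open>Bilinear products and the identities carried by an axis\<close>

context nonassoc_algebra
begin

notation scale (infixr "*s" 75)
notation mult (infixl "\<star>" 70)

lemma mult_add_right: "x \<star> (y + z) = x \<star> y + x \<star> z"
  using module_hom.add[OF linear_mult_left[of x, unfolded linear_iff_module_hom]] .

lemma mult_add_left: "(x + y) \<star> z = x \<star> z + y \<star> z"
  using module_hom.add[OF linear_mult_right[of z, unfolded linear_iff_module_hom]] .

lemma mult_scale_right: "x \<star> (c *s y) = c *s (x \<star> y)"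
  using module_hom.scale[OF linear_mult_left[of x, unfolded linear_iff_module_hom]] .

lemma mult_scale_left: "(c *s x) \<star> y = c *s (x \<star> y)"
  using module_hom.scale[OF linear_mult_right[of y, unfolded linear_iff_module_hom]] .

lemma mult_zero_right: "x \<star> 0 = 0"
  using mult_add_right[of x 0 0] by simp

lemma mult_zero_left: "0 \<star> x = 0"
  using mult_add_left[of 0 0 x] by simp

lemma mult_diff_right: "x \<star> (y - z) = x \<star> y - x \<star> z"
  using mult_add_right[of x "y - z" z] by simp

lemma mult_diff_left: "(x - y) \<star> z = x \<star> z - y \<star> z"
  using mult_add_left[of "x - y" y z] by simp

lemmas bilinear = mult_add_right mult_add_left mult_scale_right mult_scale_left
  mult_zero_right mult_zero_left mult_diff_right mult_diff_left

lemmas scale_distribs = scale_left_distrib scale_right_distrib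
  scale_left_diff_distrib scale_right_diff_distrib

lemma mem_eigenspace2: "x \<in> eigenspace2 a lam \<delta> \<longleftrightarrow> a \<star> x = lam *s x \<and> x \<star> a = \<delta> *s x"
  by (simp add: eigenspace2_def eigenspace_def L_def R_def)

text \<open>The axis conditions become pointwise identities. The last two are the cubic equations,
  read as: with \<open>T\<close> the operator, \<open>T (T v) - T v\<close> is mapped by
  \<open>T\<close> to its multiple by the third eigenvalue.\<close>

lemma axis_of_typeD:
  assumes "axis_of_type a lam \<delta>"
  shows "a \<star> a = a" "lam \<noteq> 0" "lam \<noteq> 1" "\<delta> \<noteq> 0" "\<delta> \<noteq> 1"
    and "a \<star> v = v \<Longrightarrow> \<exists>c. v = c *s a" "v \<star> a = v \<Longrightarrow> \<exists>c. v = c *s a"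
    and "a \<star> (v \<star> a) = (a \<star> v) \<star> a"
    and "a \<star> (a \<star> (a \<star> v) - a \<star> v) = lam *s (a \<star> (a \<star> v) - a \<star> v)"
    and "((v \<star> a) \<star> a - v \<star> a) \<star> a = \<delta> *s ((v \<star> a) \<star> a - v \<star> a)"
proof -
  have l: "one_sided_axis (L a) a lam" and r: "one_sided_axis (R a) a \<delta>"
    and c: "L a \<circ> R a = R a \<circ> L a"
    using assms by (auto simp: axis_of_type_def left_axis_def right_axis_def)
  show "a \<star> a = a" "lam \<noteq> 0" "lam \<noteq> 1" "\<delta> \<noteq> 0" "\<delta> \<noteq> 1"
    using l r by (auto simp: one_sided_axis_def)
  show "\<exists>c. v = c *s a" if "a \<star> v = v"
  proof -
    have "v \<in> eigenspace (L a) 1" using that by (simp add: eigenspace_def L_def)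
    then show ?thesis using l by (auto simp: one_sided_axis_def span_singleton)
  qed
  show "\<exists>c. v = c *s a" if "v \<star> a = v"
  proof -
    have "v \<in> eigenspace (R a) 1" using that by (simp add: eigenspace_def R_def)
    then show ?thesis using r by (auto simp: one_sided_axis_def span_singleton)
  qed
  show "a \<star> (v \<star> a) = (a \<star> v) \<star> a"
    using fun_cong[OF c, of v] by (simp add: L_def R_def)
  have "((\<lambda>v. L a v - lam *s v) \<circ> (\<lambda>v. L a v - v) \<circ> L a) v = 0"
    using l by (simp add: one_sided_axis_def)
  then show "a \<star> (a \<star> (a \<star> v) - a \<star> v) = lam *s (a \<star> (a \<star> v) - a \<star> v)"
    by (simp add: L_def)
  have "((\<lambda>v. R a v - \<delta> *s v) \<circ> (\<lambda>v. R a v - v) \<circ> R a) v = 0"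
    using r by (simp add: one_sided_axis_def)
  then show "((v \<star> a) \<star> a - v \<star> a) \<star> a = \<delta> *s ((v \<star> a) \<star> a - v \<star> a)"
    by (simp add: R_def)
qed

lemma left_axis_grading:
  assumes "left_axis a lam"
  obtains P where "subspace P" "a \<in> P" "eigenspace (L a) 0 \<subseteq> P"
    "\<And>v. \<exists>c u w. v = c *s a + u + w \<and> a \<star> u = 0 \<and> a \<star> w = lam *s w"
    "P \<inter> eigenspace (L a) lam = {0}"
    "\<And>x y. x \<in> P \<Longrightarrow> y \<in> P \<Longrightarrow> x \<star> y \<in> P"
    "\<And>x y. x \<in> P \<Longrightarrow> y \<in> eigenspace (L a) lam \<Longrightarrow> x \<star> y \<in> eigenspace (L a) lam"
    "\<And>x y. x \<in> eigenspace (L a) lam \<Longrightarrow> y \<in> P \<Longrightarrow> x \<star> y \<in> eigenspace (L a) lam"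
proof -
  from assms obtain P where e1: "eigenspace (L a) 1 = span {a}"
    and P: "is_direct_sum (eigenspace (L a) 0) (eigenspace (L a) 1) P"
    and G: "Z2_grading P (eigenspace (L a) lam)"
    by (auto simp: left_axis_def one_sided_axis_def)
  have PM: "is_direct_sum P (eigenspace (L a) lam) UNIV"
    using G by (simp add: Z2_grading_def)
  \<comment> \<open>With 0 in each summand, \<open>x = x + 0 = 0 + x\<close> puts either eigenspace
    inside the sum.\<close>
  have z: "(0::'v) \<in> eigenspace (L a) 0" "(0::'v) \<in> eigenspace (L a) 1"
    using P by (auto simp: is_direct_sum_def subspace_def)
  have "eigenspace (L a) 0 \<subseteq> P" "eigenspace (L a) 1 \<subseteq> P"
    using P z unfolding is_direct_sum_def by force+
  moreover have "a \<in> span {a}" by (simp add: span_base)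
  ultimately have *: "a \<in> P" "eigenspace (L a) 0 \<subseteq> P" using e1 by auto
  have "\<exists>c u w. v = c *s a + u + w \<and> a \<star> u = 0 \<and> a \<star> w = lam *s w" for v
  proof -
    obtain p w where v: "v = p + w" "p \<in> P" and w: "w \<in> eigenspace (L a) lam"
      using PM unfolding is_direct_sum_def by blast
    obtain u s where p: "p = u + s" "u \<in> eigenspace (L a) 0" "s \<in> span {a}"
      using P v e1 unfolding is_direct_sum_def by blast
    then obtain c where "s = c *s a" by (auto simp: span_singleton)
    with v w p show ?thesis
      by (intro exI[of _ c] exI[of _ u] exI[of _ w]) (simp add: eigenspace_def L_def add_ac)
  qed
  moreover have "subspace P" "P \<inter> eigenspace (L a) lam = {0}"
    using PM by (auto simp: is_direct_sum_def)
  ultimately show thesis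
    using * G by (intro that[of P]) (auto simp: Z2_grading_def)
qed

end

section \<open>Peirce components and types of axes under flexibility\<close>

context flexible_algebra
begin

text \<open>Replacing \<open>x\<close> by \<open>x + z\<close> in the flexible law and cancelling
  the two pure terms leaves the mixed ones.\<close>

lemma flexible_linearized: "(x \<star> y) \<star> z + (z \<star> y) \<star> x = x \<star> (y \<star> z) + z \<star> (y \<star> x)"
  using flexible[of "x + z" y] flexible[of x y] flexible[of z y]
  by (simp add: bilinear algebra_simps)

text \<open>Flexibility on \<open>a, a, u\<close> makes \<open>u \<star> a\<close> a fixed vector of
  \<open>R a\<close>, hence a multiple of \<open>a\<close>. Since \<open>L a\<close> and
  \<open>R a\<close> commute, \<open>L a\<close> kills it, but \<open>L a\<close> fixes every
  multiple of \<open>a\<close>.\<close>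

lemma left_null_is_right_null:
  assumes ax: "axis_of_type a lam \<delta>" and u: "a \<star> u = 0"
  shows "u \<star> a = 0"
proof -
  note D = axis_of_typeD[OF ax]
  have "(u \<star> a) \<star> a = u \<star> a"
    using flexible_linearized[of a a u] D(1) u by (simp add: bilinear)
  then obtain c where c: "u \<star> a = c *s a" using D(7) by blast
  have "a \<star> (u \<star> a) = 0" using D(8)[of u] u by (simp add: bilinear)
  then show ?thesis by (simp add: c bilinear D(1))
qed

text \<open>Flexibility makes \<open>R a\<close> satisfy a quadratic equation on \<open>w\<close>, which combined with
  the cubic equation for \<open>R a\<close> leaves only the eigenvalue \<open>\<delta>\<close>.\<close>

lemma left_odd_is_right_odd:
  assumes ax: "axis_of_type a lam \<delta>" and w: "a \<star> w = lam *s w"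
  shows "w \<star> a = \<delta> *s w"
proof -
  note D = axis_of_typeD[OF ax]
  have q: "(w \<star> a) \<star> a = w \<star> a + (lam * lam - lam) *s w"
    using flexible_linearized[of a a w] D(1) w
    by (simp add: bilinear scale_distribs algebra_simps)
  have "(lam * lam - lam) *s (w \<star> a - \<delta> *s w) = 0"
    using D(10)[of w] by (simp add: q bilinear scale_distribs algebra_simps)
  moreover have "lam * lam - lam \<noteq> 0" using D(2,3) by (simp add: algebra_simps)
  ultimately show ?thesis by (simp only: scale_eq_0_iff) simp
qed

lemma Peirce_decomposition:
  assumes "axis_of_type a lam \<delta>"
  obtains c u w where "v = c *s a + u + w" "a \<star> u = 0" "u \<star> a = 0"
    "a \<star> w = lam *s w" "w \<star> a = \<delta> *s w"
proof -
  have "left_axis a lam" using assms by (simp add: axis_of_type_def)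
  then obtain c u w where "v = c *s a + u + w" "a \<star> u = 0" "a \<star> w = lam *s w"
    by (rule left_axis_grading) blast
  then show thesis
    using that left_null_is_right_null[OF assms] left_odd_is_right_odd[OF assms] by blast
qed

text \<open>The components belong to the distinct eigenvalues 1, 0 and \<open>lam\<close> of
  \<open>L a\<close>. Applying \<open>L a\<close> once removes \<open>u\<close>; comparing with a
  second application removes \<open>a\<close>.\<close>

lemma Peirce_independent:
  assumes ax: "axis_of_type a lam \<delta>" and "a \<noteq> 0"
    and u: "a \<star> u = 0" and w: "a \<star> w = lam *s w" and s: "c *s a + u + w = 0"
  shows "c = 0 \<and> u = 0 \<and> w = 0"
proof -
  note D = axis_of_typeD[OF ax]
  have 1: "c *s a + lam *s w = 0"
    using arg_cong[OF s, of "\<lambda>v. a \<star> v"] by (simp add: bilinear D(1) u w)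
  have 2: "c *s a + (lam * lam) *s w = 0"
    using arg_cong[OF 1, of "\<lambda>v. a \<star> v"] by (simp add: bilinear D(1) w)
  have "(lam * lam - lam) *s w = (c *s a + (lam * lam) *s w) - (c *s a + lam *s w)"
    by (simp add: scale_distribs)
  then have "(lam * lam - lam) *s w = 0" using 1 2 by simp
  moreover have "lam * lam - lam \<noteq> 0" using D(2,3) by (simp add: algebra_simps)
  ultimately have "w = 0" by (simp only: scale_eq_0_iff) simp
  then show ?thesis using 1 s \<open>a \<noteq> 0\<close> by simp
qed

lemma noncentral_axis_type:
  assumes ax: "axis_of_type a lam \<delta>" and nc: "a \<notin> center"
  shows "lam + \<delta> = 1" "lam \<noteq> \<delta>" "a \<noteq> 0"
proof -
  note D = axis_of_typeD[OF ax]
  show "a \<noteq> 0" using nc by (auto simp: center_def bilinear)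
  obtain v where v: "a \<star> v \<noteq> v \<star> a" using nc by (auto simp: center_def)
  obtain c u w where d: "v = c *s a + u + w" "a \<star> u = 0" "u \<star> a = 0"
    and w: "a \<star> w = lam *s w" "w \<star> a = \<delta> *s w"
    by (rule Peirce_decomposition[OF ax])
  \<comment> \<open>On the first two components \<open>a\<close> acts alike from both sides, so the
    failure to commute comes from the odd component.\<close>
  have "lam *s w \<noteq> \<delta> *s w" using v by (simp add: d w bilinear)
  then have w0: "w \<noteq> 0" and "lam \<noteq> \<delta>" by auto
  \<comment> \<open>Flexibility on \<open>w\<close> reads
    \<open>lam + \<delta> * \<delta> = lam * lam + \<delta>\<close> in coefficients, which
    factors.\<close>
  have "((lam - \<delta>) * (1 - lam - \<delta>)) *s w = 0"
    using flexible_linearized[of a a w] D(1) w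
    by (simp add: bilinear scale_distribs algebra_simps)
  with w0 \<open>lam \<noteq> \<delta>\<close> have "1 - lam - \<delta> = 0" by simp
  then show "lam + \<delta> = 1" by (simp add: algebra_simps)
  show "lam \<noteq> \<delta>" by fact
qed

text \<open>The flexible law \<open>(w \<star> a) \<star> w = w \<star> (a \<star> w)\<close> gives
  \<open>w \<star> w\<close> the coefficient \<open>\<delta>\<close> on one side and
  \<open>lam\<close> on the other.\<close>

lemma odd_square_zero:
  assumes "a \<star> w = lam *s w" "w \<star> a = \<delta> *s w" "lam \<noteq> \<delta>"
  shows "w \<star> w = 0"
proof -
  have "(\<delta> - lam) *s (w \<star> w) = 0"
    using flexible[of w a] assms(1,2) by (simp add: bilinear scale_distribs)
  then show ?thesis using assms(3) by simp
qed

lemma axis_Jordan_type: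
  assumes "axis a"
  shows "\<exists>lam \<delta>. axis_of_Jordan_type a lam \<delta> \<and>
    ((lam = \<delta> \<and> a \<in> center) \<or>
     (lam + \<delta> = 1 \<and> lam \<noteq> \<delta> \<and> (\<forall>x \<in> eigenspace2 a lam \<delta>. x \<star> x = 0)))"
proof -
  obtain lam \<delta> where ax: "axis_of_type a lam \<delta>" using assms by (auto simp: axis_def)
  have J: "axis_of_Jordan_type a lam \<delta>" if ax: "axis_of_type a lam \<delta>" for lam \<delta>
  proof -
    note D = axis_of_typeD[OF ax]
    \<comment> \<open>Left odd vectors have right eigenvalue \<open>\<delta>\<close> and left null
      vectors have right eigenvalue 0, so both mixed spaces vanish because \<open>\<delta>\<close>
      is nonzero.\<close>
    have "x = 0" if "x \<in> eigenspace2 a lam 0" for x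
      using that left_odd_is_right_odd[OF ax, of x] D(4) by (simp add: mem_eigenspace2)
    moreover have "x = 0" if "x \<in> eigenspace2 a 0 \<delta>" for x
      using that left_null_is_right_null[OF ax, of x] D(4) by (simp add: mem_eigenspace2)
    moreover have "0 \<in> eigenspace2 a lam 0" "0 \<in> eigenspace2 a 0 \<delta>"
      by (simp_all add: mem_eigenspace2 bilinear)
    ultimately show ?thesis using ax unfolding axis_of_Jordan_type_def by blast
  qed
  show ?thesis
  proof (cases "a \<in> center")
    case True
    \<comment> \<open>The given \<open>\<delta>\<close> may differ from \<open>lam\<close> when the
      odd part is zero; as the two operators coincide, the type can be rechosen as
      \<open>(lam, lam)\<close>.\<close>
    then have "L a = R a" by (auto simp: center_def L_def R_def)
    then have "axis_of_type a lam lam"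
      using ax by (simp add: axis_of_type_def left_axis_def right_axis_def)
    then show ?thesis using J True by blast
  next
    case False
    note N = noncentral_axis_type[OF ax False]
    have "\<forall>x \<in> eigenspace2 a lam \<delta>. x \<star> x = 0"
      using odd_square_zero N(2) by (auto simp: mem_eigenspace2)
    then show ?thesis using J[OF ax] N by blast
  qed
qed

text \<open>The odd part of \<open>b \<star> b = b\<close> reads \<open>u \<star> w + w \<star> u = (1 - \<alpha>) w\<close>, and flexibility
  splits this sum in the ratio \<open>\<delta> : lam\<close>.\<close>

lemma idempotent_odd_component:
  assumes ax: "axis_of_type a lam \<delta>" and sum1: "lam + \<delta> = 1" and ne: "lam \<noteq> \<delta>"
    and b: "b = \<alpha> *s a + u + w" and idem: "b \<star> b = b"
    and u: "a \<star> u = 0" "u \<star> a = 0" and w: "a \<star> w = lam *s w" "w \<star> a = \<delta> *s w"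
  shows "b \<star> w = (\<alpha> * lam + (1 - \<alpha>) * \<delta>) *s w" "w \<star> b = (\<alpha> * \<delta> + (1 - \<alpha>) * lam) *s w"
proof -
  note D = axis_of_typeD[OF ax]
  have ww: "w \<star> w = 0" using odd_square_zero[OF w ne] .
  have "left_axis a lam" using ax by (simp add: axis_of_type_def)
  then obtain P where P: "subspace P" "a \<in> P" "eigenspace (L a) 0 \<subseteq> P"
    and PM: "P \<inter> eigenspace (L a) lam = {0}"
    and PP: "\<And>x y. x \<in> P \<Longrightarrow> y \<in> P \<Longrightarrow> x \<star> y \<in> P"
    and PM1: "\<And>x y. x \<in> P \<Longrightarrow> y \<in> eigenspace (L a) lam \<Longrightarrow> x \<star> y \<in> eigenspace (L a) lam"
    and PM2: "\<And>x y. x \<in> eigenspace (L a) lam \<Longrightarrow> y \<in> P \<Longrightarrow> x \<star> y \<in> eigenspace (L a) lam"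
    by (rule left_axis_grading) blast
  have uP: "u \<in> P" using P(3) u by (auto simp: eigenspace_def L_def)
  have wM: "w \<in> eigenspace (L a) lam" using w by (simp add: eigenspace_def L_def)
  have uw: "a \<star> (u \<star> w) = lam *s (u \<star> w)" and wu: "a \<star> (w \<star> u) = lam *s (w \<star> u)"
    using PM1[OF uP wM] PM2[OF wM uP] by (simp_all add: eigenspace_def L_def)
  \<comment> \<open>\<open>e\<close> is the even part of \<open>b - b \<star> b\<close> and
    \<open>t\<close> the odd part of \<open>b \<star> b - b\<close>. Idempotence makes them equal,
    so both vanish.\<close>
  define e where "e = \<alpha> *s a + u - ((\<alpha> * \<alpha>) *s a + u \<star> u)"
  define t where "t = \<alpha> *s w + (u \<star> w + w \<star> u) - w"
  have "e \<in> P" unfolding e_def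
    by (intro subspace_diff[OF P(1)] subspace_add[OF P(1)] subspace_scale[OF P(1)] P(2) uP PP)
  moreover have "e = t"
  proof -
    have "\<alpha> *s w = (\<alpha> * lam) *s w + (\<alpha> * \<delta>) *s w"
      using sum1 by (metis scale_left_distrib distrib_left mult.right_neutral)
    then show ?thesis
      using idem unfolding b e_def t_def
      by (simp add: bilinear u w D(1) ww scale_distribs algebra_simps)
  qed
  moreover have "t \<in> eigenspace (L a) lam"
    by (simp add: t_def eigenspace_def L_def bilinear uw wu w scale_distribs mult.commute)
  ultimately have "t = 0" using PM by auto
  then have t: "u \<star> w + w \<star> u = (1 - \<alpha>) *s w"
    by (simp add: t_def scale_distribs algebra_simps)
  \<comment> \<open>Flexibility on \<open>a, u, w\<close> reduces to
    \<open>(w \<star> u) \<star> a = a \<star> (u \<star> w)\<close>, and both products are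
    odd.\<close>
  have "\<delta> *s (w \<star> u) = lam *s (u \<star> w)"
    using flexible_linearized[of a u w] left_odd_is_right_odd[OF ax wu]
    by (simp add: u bilinear uw)
  then have "\<delta> *s (u \<star> w + w \<star> u) = (lam + \<delta>) *s (u \<star> w)"
    "lam *s (u \<star> w + w \<star> u) = (lam + \<delta>) *s (w \<star> u)"
    by (simp_all add: scale_distribs)
  then have "u \<star> w = (\<delta> * (1 - \<alpha>)) *s w" "w \<star> u = (lam * (1 - \<alpha>)) *s w"
    by (simp_all add: sum1 t)
  then show "b \<star> w = (\<alpha> * lam + (1 - \<alpha>) * \<delta>) *s w"
    "w \<star> b = (\<alpha> * \<delta> + (1 - \<alpha>) * lam) *s w"
    unfolding b by (simp_all add: bilinear w ww scale_left_distrib mult.commute)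
qed

end

section \<open>Coordinate models of generated subalgebras\<close>

text \<open>Homomorphisms are easier to define on coordinates, while \<open>algebra_iso\<close> maps
  out of the subalgebra; the inverse of a bijective homomorphism is again one.\<close>

lemma isomorphic_algebras_inverse:
  assumes bij: "bij_betw \<psi> UNIV S"
    and add: "\<And>x y. \<psi> (x + y) = \<psi> x + \<psi> y"
    and scale: "\<And>c x. \<psi> (scale' c x) = scale c (\<psi> x)"
    and mult: "\<And>x y. \<psi> (mult' x y) = mult (\<psi> x) (\<psi> y)"
  shows "isomorphic_algebras scale mult S scale' mult' UNIV"
proof -
  have inj: "inj \<psi>" and S: "S = range \<psi>" using bij by (auto simp: bij_betw_def)
  have "algebra_iso scale mult S scale' mult' UNIV (inv \<psi>)"
    unfolding algebra_iso_def
  proof (intro conjI ballI allI)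
    show "bij_betw (inv \<psi>) S UNIV" using bij by (rule bij_betw_inv_into)
  qed (auto simp: S inj add[symmetric] scale[symmetric] mult[symmetric])
  then show ?thesis by (auto simp: isomorphic_algebras_def)
qed

context nonassoc_algebra
begin

lemma generated_subalgebra_eqI:
  assumes "subalgebra S" "X \<subseteq> S" "\<And>T. subalgebra T \<Longrightarrow> X \<subseteq> T \<Longrightarrow> S \<subseteq> T"
  shows "generated_subalgebra X = S"
  unfolding generated_subalgebra_def using assms by (intro hull_unique) auto

text \<open>The table makes the coordinate map \<open>\<psi>\<close> multiplicative, so its range is
  a subalgebra, and the smallest one containing \<open>a\<close> and \<open>b\<close>; independence
  makes \<open>\<psi>\<close> injective.\<close>

lemma generated_isomorphic_B1:
  assumes tab: "a \<star> a = a" "b \<star> b = b" "a \<star> b = \<delta> *s a + lam *s b" "b \<star> a = lam *s a + \<delta> *s b"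
    and ind: "\<And>p q. p *s a + q *s b = 0 \<Longrightarrow> p = 0 \<and> q = 0"
  shows "isomorphic_algebras scale mult (generated_subalgebra {a, b}) B1_scale (B1_mult lam \<delta>) UNIV"
proof -
  define \<psi> where "\<psi> = (\<lambda>(p, q). p *s a + q *s b)"
  have add: "\<psi> (x + y) = \<psi> x + \<psi> y" for x y
    by (cases x; cases y) (simp add: \<psi>_def scale_distribs)
  have scale: "\<psi> (B1_scale c x) = c *s \<psi> x" for c x
    by (cases x) (simp add: \<psi>_def scale_distribs)
  have mult: "\<psi> (B1_mult lam \<delta> x y) = \<psi> x \<star> \<psi> y" for x y
    by (cases x; cases y) (simp add: \<psi>_def bilinear tab scale_distribs algebra_simps)
  have "inj \<psi>"
  proof (rule injI)
    fix x y assume "\<psi> x = \<psi> y"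
    then have "(fst x - fst y) *s a + (snd x - snd y) *s b = 0"
      by (simp add: \<psi>_def case_prod_beta scale_distribs algebra_simps)
    from ind[OF this] show "x = y" by (simp add: prod_eq_iff)
  qed
  moreover have "generated_subalgebra {a, b} = range \<psi>"
  proof (rule generated_subalgebra_eqI)
    have "\<psi> (0, 0) = 0" by (simp add: \<psi>_def)
    then have "0 \<in> range \<psi>" by (metis rangeI)
    then have "subspace (range \<psi>)"
      by (auto simp: subspace_def add[symmetric] scale[symmetric])
    then show "subalgebra (range \<psi>)"
      by (auto simp: subalgebra_def mult[symmetric])
    have "a = \<psi> (1, 0)" "b = \<psi> (0, 1)" by (simp_all add: \<psi>_def)
    then show "{a, b} \<subseteq> range \<psi>" by blast
    show "range \<psi> \<subseteq> T" if "subalgebra T" "{a, b} \<subseteq> T" for T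
      using that by (auto simp: \<psi>_def subalgebra_def intro!: subspace_add subspace_scale)
  qed
  ultimately show ?thesis
    by (intro isomorphic_algebras_inverse[of \<psi>]) (simp_all add: bij_betw_def add scale mult)
qed

lemma generated_isomorphic_B2:
  assumes tab: "a \<star> a = a" "b \<star> b = b" "x \<star> x = 0"
    "a \<star> b = lam *s x" "a \<star> x = lam *s x" "x \<star> b = lam *s x"
    "b \<star> a = \<delta> *s x" "x \<star> a = \<delta> *s x" "b \<star> x = \<delta> *s x"
    and ind: "\<And>p q r. p *s a + q *s b + r *s x = 0 \<Longrightarrow> p = 0 \<and> q = 0 \<and> r = 0"
    and "lam \<noteq> 0"
  shows "isomorphic_algebras scale mult (generated_subalgebra {a, b}) B2_scale (B2_mult lam \<delta>) UNIV"
proof -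
  define \<psi> where "\<psi> = (\<lambda>(p, q, r). p *s a + q *s b + r *s x)"
  have add: "\<psi> (y + z) = \<psi> y + \<psi> z" for y z
    by (cases y; cases z) (simp add: \<psi>_def scale_distribs)
  have scale: "\<psi> (B2_scale c y) = c *s \<psi> y" for c y
    by (cases y) (simp add: \<psi>_def scale_distribs)
  have mult: "\<psi> (B2_mult lam \<delta> y z) = \<psi> y \<star> \<psi> z" for y z
    by (cases y; cases z) (simp add: \<psi>_def bilinear tab scale_distribs algebra_simps)
  have "inj \<psi>"
  proof (rule injI)
    fix y z assume "\<psi> y = \<psi> z"
    then have "(fst y - fst z) *s a + (fst (snd y) - fst (snd z)) *s b
        + (snd (snd y) - snd (snd z)) *s x = 0"
      by (simp add: \<psi>_def case_prod_beta scale_distribs algebra_simps)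
    from ind[OF this] show "y = z" by (simp add: prod_eq_iff)
  qed
  moreover have "generated_subalgebra {a, b} = range \<psi>"
  proof (rule generated_subalgebra_eqI)
    have "\<psi> (0, 0, 0) = 0" by (simp add: \<psi>_def)
    then have "0 \<in> range \<psi>" by (metis rangeI)
    then have "subspace (range \<psi>)"
      by (auto simp: subspace_def add[symmetric] scale[symmetric])
    then show "subalgebra (range \<psi>)"
      by (auto simp: subalgebra_def mult[symmetric])
    have "a = \<psi> (1, 0, 0)" "b = \<psi> (0, 1, 0)" by (simp_all add: \<psi>_def)
    then show "{a, b} \<subseteq> range \<psi>" by blast
    show "range \<psi> \<subseteq> T" if T: "subalgebra T" "{a, b} \<subseteq> T" for T
    proof -
      \<comment> \<open>\<open>x\<close> is not among the generators, but it is recovered from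
        \<open>a \<star> b = lam *s x\<close>.\<close>
      have "x = inverse lam *s (a \<star> b)" using \<open>lam \<noteq> 0\<close> by (simp add: tab)
      then have "x \<in> T" using T by (auto simp: subalgebra_def intro!: subspace_scale)
      then show ?thesis
        using T by (auto simp: \<psi>_def subalgebra_def intro!: subspace_add subspace_scale)
    qed
  qed
  ultimately show ?thesis
    by (intro isomorphic_algebras_inverse[of \<psi>]) (simp_all add: bij_betw_def add scale mult)
qed

end

section \<open>Pairs of noncentral axes\<close>

context flexible_algebra
begin

lemma two_noncentral_axes:
  assumes "a \<noteq> b" and a: "axis_of_type a lam \<delta>" "a \<notin> center"
    and b: "axis_of_type b lam' \<delta>'" "b \<notin> center"
    and ab: "a \<star> b \<noteq> 0"
  shows "isomorphic_algebras scale mult (generated_subalgebra {a, b}) B1_scale (B1_mult lam \<delta>) UNIV \<or>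
    isomorphic_algebras scale mult (generated_subalgebra {a, b}) B2_scale (B2_mult lam \<delta>) UNIV"
proof -
  note Da = axis_of_typeD[OF a(1)] and Db = axis_of_typeD[OF b(1)]
  note Na = noncentral_axis_type[OF a] and Nb = noncentral_axis_type[OF b]
  obtain \<alpha> u w where d: "b = \<alpha> *s a + u + w" and u: "a \<star> u = 0" "u \<star> a = 0"
    and w: "a \<star> w = lam *s w" "w \<star> a = \<delta> *s w"
    by (rule Peirce_decomposition[OF a(1)])
  note indep = Peirce_independent[OF a(1) Na(3)]
  have ww: "w \<star> w = 0" using odd_square_zero[OF w Na(2)] .
  have mab: "a \<star> b = \<alpha> *s a + lam *s w" and mba: "b \<star> a = \<alpha> *s a + \<delta> *s w"
    by (simp_all add: d bilinear u w Da(1))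
  \<comment> \<open>The left eigenvalue of \<open>b\<close> on \<open>w\<close>; the right one is
    \<open>1 - \<mu>\<close> because \<open>lam + \<delta> = 1\<close>.\<close>
  define \<mu> where "\<mu> = \<alpha> * lam + (1 - \<alpha>) * \<delta>"
  have bw: "b \<star> w = \<mu> *s w" and wb: "w \<star> b = (1 - \<mu>) *s w"
  proof -
    have \<delta>: "\<delta> = 1 - lam" using Na(1) by (simp add: algebra_simps)
    have "1 - \<mu> = \<alpha> * \<delta> + (1 - \<alpha>) * lam" unfolding \<mu>_def \<delta> by (simp add: algebra_simps)
    then show "b \<star> w = \<mu> *s w" "w \<star> b = (1 - \<mu>) *s w"
      using idempotent_odd_component[OF a(1) Na(1,2) d Db(1) u w] by (simp_all add: \<mu>_def)
  qed
  \<comment> \<open>\<open>L b\<close> maps the span of \<open>a\<close> and \<open>w\<close> into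
    itself, triangularly with diagonal entries \<open>\<alpha>\<close> and \<open>\<mu>\<close>. The
    claim is the \<open>a\<close>-coefficient of the cubic equation on \<open>a\<close>; the summand
    0 below stands for the null component.\<close>
  have poly: "\<alpha> * (\<alpha> - 1) * (\<alpha> - lam') = 0"
  proof -
    have "(\<alpha> * (\<alpha> - 1) * (\<alpha> - lam')) *s a + 0
        + (\<delta> * (\<alpha> * (\<alpha> - 1) + (\<mu> - lam') * (\<alpha> + \<mu> - 1))) *s w = 0"
      using Db(9)[of a] by (simp add: mba bilinear bw scale_distribs algebra_simps)
    from indep[OF _ _ this] show ?thesis using w by (simp add: bilinear mult.commute)
  qed
  show ?thesis
  proof (cases "w = 0")
    case True
    have "\<alpha> \<noteq> 0" using ab mab True by auto
    then consider "\<alpha> = 1" | "\<alpha> = lam'" using poly by auto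
    then have False
    proof cases
      case 1
      \<comment> \<open>\<open>L b\<close> fixes \<open>a\<close>, so \<open>a\<close> is a multiple
        of \<open>b\<close>; an idempotent multiple of a nonzero idempotent is 0 or that
        idempotent.\<close>
      then obtain c where c: "a = c *s b" using Db(6)[of a] mba True by auto
      then have "c *s b = (c * c) *s b" using Da(1) Db(1) by (simp add: bilinear)
      then have "c = 0 \<or> c = 1" using Nb(3) by simp
      then show False using c Na(3) \<open>a \<noteq> b\<close> by auto
    next
      case 2
      \<comment> \<open>Now \<open>a\<close> is odd with respect to \<open>b\<close>, so it squares
        to zero, unlike a nonzero idempotent.\<close>
      then have ba: "b \<star> a = lam' *s a" using mba True by simp
      have "a \<star> a = 0"
        using odd_square_zero[OF ba left_odd_is_right_odd[OF b(1) ba] Nb(2)] .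
      then show False using Da(1) Na(3) by simp
    qed
    then show ?thesis ..
  next
    case False
    \<comment> \<open>Eigenvectors of \<open>L b\<close> for 0 and 1 commute with \<open>b\<close>.
      But for \<open>\<mu>\<close> equal to 0 or 1, one of \<open>b \<star> w\<close> and
      \<open>w \<star> b\<close> is 0 and the other is \<open>w\<close>.\<close>
    have "\<mu> = lam'"
    proof -
      have "(\<mu> * (\<mu> - 1) * (\<mu> - lam')) *s w = 0"
        using Db(9)[of w] by (simp add: bw bilinear scale_distribs algebra_simps)
      moreover have "\<mu> \<noteq> 0"
        using left_null_is_right_null[OF b(1), of w] bw wb False by auto
      moreover have "\<mu> \<noteq> 1"
      proof
        assume "\<mu> = 1"
        then have "b \<star> w = w" "w \<star> b = 0" using bw wb by simp_all
        then show False using Db(6)[of w] Db(1) False by (auto simp: bilinear)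
      qed
      ultimately show ?thesis using False by simp
    qed
    \<comment> \<open>Otherwise \<open>\<alpha> = \<mu>\<close>, which forces
      \<open>\<alpha> + \<alpha> = 1\<close>, so \<open>lam' = \<delta>'\<close> against the
      noncentrality of \<open>b\<close>.\<close>
    have "\<alpha> \<noteq> lam'"
    proof
      assume "\<alpha> = lam'"
      have \<delta>: "\<delta> = 1 - lam" using Na(1) by (simp add: algebra_simps)
      have "\<mu> - \<alpha> = \<delta> * (1 - \<alpha> - \<alpha>)" unfolding \<mu>_def \<delta> by (simp add: algebra_simps)
      then have "\<delta> * (1 - \<alpha> - \<alpha>) = 0" using \<open>\<mu> = lam'\<close> \<open>\<alpha> = lam'\<close> by simp
      then have "lam' + lam' = 1" using Da(4) \<open>\<alpha> = lam'\<close> by (simp add: algebra_simps)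
      then show False using Nb(1,2) by (metis add_left_cancel)
    qed
    then consider "\<alpha> = 1" | "\<alpha> = 0" using poly by auto
    then show ?thesis
    proof cases
      case 1
      \<comment> \<open>Here \<open>\<mu> = lam\<close>, so \<open>L b\<close> fixes
        \<open>a + w\<close>, which is therefore a multiple of \<open>b = a + u + w\<close>;
        comparing components gives \<open>u = 0\<close>.\<close>
      have "b \<star> (a + w) = a + (\<delta> + lam) *s w"
        by (simp add: bilinear mba bw 1 \<mu>_def scale_distribs)
      then have "b \<star> (a + w) = a + w" using Na(1) by (simp add: add.commute)
      then obtain c where "a + w = c *s b" using Db(6) by blast
      then have "(c - 1) *s a + c *s u + (c - 1) *s w = 0"
        by (simp add: d 1 scale_distribs algebra_simps)
      from indep[OF _ _ this] have "u = 0" using w u by (auto simp: bilinear mult.commute)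
      then have b': "b = a + w" using d 1 by simp
      have \<delta>: "\<delta> = 1 - lam" using Na(1) by (simp add: algebra_simps)
      have "isomorphic_algebras scale mult (generated_subalgebra {a, b})
          B1_scale (B1_mult lam \<delta>) UNIV"
      proof (rule generated_isomorphic_B1)
        show "a \<star> a = a" "b \<star> b = b" by (fact Da(1) Db(1))+
        show "a \<star> b = \<delta> *s a + lam *s b" "b \<star> a = lam *s a + \<delta> *s b"
          unfolding mab mba 1 by (simp_all add: b' \<delta> scale_distribs algebra_simps)
        show "p = 0 \<and> q = 0" if "p *s a + q *s b = 0" for p q
        proof -
          have "(p + q) *s a + 0 + q *s w = 0"
            using that by (simp add: b' scale_distribs algebra_simps)
          from indep[OF _ _ this] show ?thesis
            using w False by (auto simp: bilinear mult.commute)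
        qed
      qed
      then show ?thesis ..
    next
      case 2
      have b': "b = u + w" using d 2 by simp
      \<comment> \<open>If \<open>u\<close> vanished, the nonzero idempotent \<open>b = w\<close>
        would have square zero.\<close>
      have "u \<noteq> 0" using b' ww Db(1) Nb(3) by auto
      have \<mu>: "\<mu> = \<delta>" "1 - \<mu> = lam" using Na(1) by (simp_all add: \<mu>_def 2 algebra_simps)
      have "isomorphic_algebras scale mult (generated_subalgebra {a, b})
          B2_scale (B2_mult lam \<delta>) UNIV"
      proof (rule generated_isomorphic_B2)
        show "a \<star> a = a" "b \<star> b = b" "w \<star> w = 0" "lam \<noteq> 0" by (fact Da(1,2) Db(1) ww)+
        show "a \<star> b = lam *s w" "a \<star> w = lam *s w" "w \<star> b = lam *s w"
          "b \<star> a = \<delta> *s w" "w \<star> a = \<delta> *s w" "b \<star> w = \<delta> *s w"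
          using \<mu> by (simp_all add: mab mba 2 w bw wb)
        show "p = 0 \<and> q = 0 \<and> r = 0" if "p *s a + q *s b + r *s w = 0" for p q r
        proof -
          have "p *s a + q *s u + (q + r) *s w = 0"
            using that by (simp add: b' scale_distribs algebra_simps)
          from indep[OF _ _ this] show ?thesis
            using w u False \<open>u \<noteq> 0\<close> by (auto simp: bilinear mult.commute)
        qed
      qed
      then show ?thesis ..
    qed
  qed
qed

end

theorem theoremD:
  fixes scale :: "'f::field \<Rightarrow> 'v::ab_group_add \<Rightarrow> 'v"
    and mult :: "'v \<Rightarrow> 'v \<Rightarrow> 'v"
  assumes A: "flexible_algebra scale mult"
    and char: "CHAR('f) \<noteq> 2"
  shows
    "(\<forall>a. nonassoc_algebra.axis scale mult a \<longrightarrow>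
        (\<exists>lam \<delta>. nonassoc_algebra.axis_of_Jordan_type scale mult a lam \<delta> \<and>
          ((lam = \<delta> \<and> a \<in> nonassoc_algebra.center mult) \<or>
           (lam + \<delta> = 1 \<and> lam \<noteq> \<delta> \<and>
             (\<forall>x \<in> nonassoc_algebra.eigenspace2 scale mult a lam \<delta>. mult x x = 0))))) \<and>
     (\<forall>a b. a \<noteq> b \<longrightarrow>
        nonassoc_algebra.axis scale mult a \<longrightarrow> nonassoc_algebra.axis scale mult b \<longrightarrow>
        a \<notin> nonassoc_algebra.center mult \<longrightarrow> b \<notin> nonassoc_algebra.center mult \<longrightarrow>
        mult a b = 0 \<or>
        (\<exists>lam \<delta>. lam \<notin> {0, 1} \<and> \<delta> \<notin> {0, 1} \<and> lam + \<delta> = 1 \<and> lam \<noteq> \<delta> \<and>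
          (isomorphic_algebras scale mult
             (nonassoc_algebra.generated_subalgebra scale mult {a, b})
             B1_scale (B1_mult lam \<delta>) UNIV \<or>
           isomorphic_algebras scale mult
             (nonassoc_algebra.generated_subalgebra scale mult {a, b})
             B2_scale (B2_mult lam \<delta>) UNIV)))"
proof -
  interpret flexible_algebra scale mult by (fact A)
  have "\<exists>lam \<delta>. lam \<notin> {0, 1} \<and> \<delta> \<notin> {0, 1} \<and> lam + \<delta> = 1 \<and> lam \<noteq> \<delta> \<and>
      (isomorphic_algebras scale mult (generated_subalgebra {a, b}) B1_scale (B1_mult lam \<delta>) UNIV \<or>
       isomorphic_algebras scale mult (generated_subalgebra {a, b}) B2_scale (B2_mult lam \<delta>) UNIV)"
    if "a \<noteq> b" "axis a" "axis b" "a \<notin> center" "b \<notin> center" "mult a b \<noteq> 0" for a b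
  proof -
    obtain lam \<delta> lam' \<delta>' where ax: "axis_of_type a lam \<delta>" "axis_of_type b lam' \<delta>'"
      using \<open>axis a\<close> \<open>axis b\<close> unfolding axis_def by blast
    \<comment> \<open>The type of \<open>a\<close> supplies the parameters of the model
      algebra.\<close>
    have "lam \<notin> {0, 1}" "\<delta> \<notin> {0, 1}" using axis_of_typeD(2-5)[OF ax(1)] by simp_all
    then show ?thesis
      using noncentral_axis_type[OF ax(1)] two_noncentral_axes[OF _ ax(1) _ ax(2)] that by blast
  qed
  then show ?thesis using axis_Jordan_type by blast
qed

end
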